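(* Let $A\subset B$ be an integral ring extension of integral domains. Suppose that $A$ is a noetherian domain of (Krull) dimension $1$ with finite integral closure, i.e., the integral closure $\overline{A}$ of $A$ in its field of fractions is a finitely generated $A$-module (for example, $A$ is a Nagata ring). Then the function $\mathrm{d}:\mathrm{Spec}(A)\to\mathbb{N}\cup\{\infty\}$ defined by $\mathrm{d}(\mathfrak{p})=\mathrm{d}_{A_{\mathfrak{p}}}(B_{\mathfrak{p}})$ is upper-semicontinuous.
   Context: All rings are commutative with unity. For an integral ring extension $A\subset B$ of integral domains and $b\in B$, the integral degree of $b$ over $A$, denoted $\mathrm{id}_A(b)$, is the minimum integer $n\geq 1$ such that $b$ is a root of a monic polynomial of degree $n$ in $A[T]$. The integral degree of $B$ over $A$ is $\mathrm{d}_A(B)=\sup\{\mathrm{id}_A(b)\mid b\in B\}$ (possibly $\infty$). For $\mathfrak{p}\in\mathrm{Spec}(A)$, $B_{\mathfrak{p}}$ denotes the localization of $B$ at the multiplicative set $A\setminus\mathfrak{p}$; the extension $A_{\mathfrak{p}}\subset B_{\mathfrak{p}}$ is integral. The function $\mathrm{d}$ is upper-semicontinuous if $\{\mathfrak{p}\in\mathrm{Spec}(A)\mid \mathrm{d}(\mathfrak{p})\geq n\}$ is closed in $\mathrm{Spec}(A)$ (Zariski topology) for every integer $n\geq 1$. *)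

theory Defs
  imports
    "HOL-Algebra.Algebraic_Closure_Type"
    "HOL-Analysis.Abstract_Topology"
    "HOL-Library.Extended_Nat"
begin

text \<open>Rings are subsets of a type of class \<open>idom\<close>, so that polynomials and fractions are those of
  the type classes. To such a subset we apply the \<open>HOL-Algebra\<close> predicates through its record.\<close>

abbreviation ring_on :: "'a::idom set \<Rightarrow> 'a ring"
  where "ring_on A \<equiv> ring_of_type_algebra\<lparr>carrier := A\<rparr>"

definition ring_extension :: "'a::idom set \<Rightarrow> 'a set \<Rightarrow> bool"
  where "ring_extension A B \<longleftrightarrow>
    subring A ring_of_type_algebra \<and> subring B ring_of_type_algebra \<and> A \<subseteq> B"


section \<open>Prime spectrum and Krull dimension\<close>

definition Spec :: "'a::idom set \<Rightarrow> 'a set set"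
  where "Spec A = {P. primeideal P (ring_on A)}"

definition krull_dim :: "'a::idom set \<Rightarrow> enat"
  where "krull_dim A =
    Sup {enat n | n. \<exists>P. (\<forall>i\<le>n. P i \<in> Spec A) \<and> (\<forall>i<n. P i \<subset> P (Suc i))}"

definition zariski_closed_set :: "'a::idom set \<Rightarrow> 'a set \<Rightarrow> 'a set set"
  where "zariski_closed_set A E = {P \<in> Spec A. E \<subseteq> P}"

definition zariski :: "'a::idom set \<Rightarrow> 'a set topology"
  where "zariski A = topology (\<lambda>U. \<exists>E\<subseteq>A. U = Spec A - zariski_closed_set A E)"

lemma istopology_zariski:
  assumes "subring A ring_of_type_algebra"
  shows "istopology (\<lambda>U. \<exists>E\<subseteq>A. U = Spec A - zariski_closed_set A E)"
  unfolding istopology_def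
proof (intro conjI allI impI)
  fix S T
  assume "\<exists>E\<subseteq>A. S = Spec A - zariski_closed_set A E" "\<exists>E\<subseteq>A. T = Spec A - zariski_closed_set A E"
  then obtain E F where E: "E \<subseteq> A" "S = Spec A - zariski_closed_set A E"
    and F: "F \<subseteq> A" "T = Spec A - zariski_closed_set A F" by blast
  let ?G = "{x * y | x y. x \<in> E \<and> y \<in> F}"
  have "?G \<subseteq> A"
  proof clarify
    fix x y assume "x \<in> E" "y \<in> F"
    then show "x * y \<in> A"
      using E(1) F(1) submonoid.m_closed[OF subring.axioms(2)[OF assms], of x y]
      by (auto simp: ring_of_type_algebra_def)
  qed
  moreover have "S \<inter> T = Spec A - zariski_closed_set A ?G"
  proof -
    have "?G \<subseteq> P \<longleftrightarrow> E \<subseteq> P \<or> F \<subseteq> P" if "P \<in> Spec A" for P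
    proof -
      interpret primeideal P "ring_on A" using that by (simp add: Spec_def)
      have "x * y \<in> P" if "x \<in> A" "y \<in> A" "x \<in> P \<or> y \<in> P" for x y
        using that I_l_closed[of y x] I_r_closed[of x y] by (auto simp: ring_of_type_algebra_def)
      moreover have "x \<in> P \<or> y \<in> P" if "x \<in> A" "y \<in> A" "x * y \<in> P" for x y
        using that I_prime[of x y] by (auto simp: ring_of_type_algebra_def)
      ultimately show ?thesis using E(1) F(1) by blast
    qed
    then show ?thesis unfolding E(2) F(2) zariski_closed_set_def by blast
  qed
  ultimately show "\<exists>E\<subseteq>A. S \<inter> T = Spec A - zariski_closed_set A E" by blast
next
  fix K
  assume "\<forall>U\<in>K. \<exists>E\<subseteq>A. U = Spec A - zariski_closed_set A E"
  then obtain E where E: "\<And>U. U \<in> K \<Longrightarrow> E U \<subseteq> A \<and> U = Spec A - zariski_closed_set A (E U)"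
    by metis
  have "\<Union>K = (\<Union>U\<in>K. Spec A - zariski_closed_set A (E U))" using E by auto
  also have "\<dots> = Spec A - zariski_closed_set A (\<Union>U\<in>K. E U)"
    unfolding zariski_closed_set_def by blast
  finally show "\<exists>E\<subseteq>A. \<Union>K = Spec A - zariski_closed_set A E"
    using E by (intro exI[of _ "\<Union>U\<in>K. E U"]) auto
qed

lemma closedin_zariski:
  assumes "subring A ring_of_type_algebra"
  shows "closedin (zariski A) C \<longleftrightarrow> (\<exists>E\<subseteq>A. C = zariski_closed_set A E)"
proof -
  have op: "openin (zariski A) U \<longleftrightarrow> (\<exists>E\<subseteq>A. U = Spec A - zariski_closed_set A E)" for U
    unfolding zariski_def using istopology_zariski[OF assms] by (simp add: topology_inverse')
  have "openin (zariski A) (Spec A)"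
  proof -
    have one: "1 \<in> A"
      using submonoid.one_closed[OF subring.axioms(2)[OF assms]]
      by (simp add: ring_of_type_algebra_def)
    have "1 \<notin> P" if "P \<in> Spec A" for P
    proof -
      interpret primeideal P "ring_on A" using that by (simp add: Spec_def)
      show ?thesis using one_imp_carrier I_notcarr by (auto simp: ring_of_type_algebra_def)
    qed
    then have "Spec A = Spec A - zariski_closed_set A {1}" by (auto simp: zariski_closed_set_def)
    then show ?thesis unfolding op using one by blast
  qed
  then have "topspace (zariski A) = Spec A"
    unfolding topspace_def using op by blast
  moreover have "C \<subseteq> Spec A \<and> Spec A - C = Spec A - zariski_closed_set A E
      \<longleftrightarrow> C = zariski_closed_set A E" for E
    by (auto simp: zariski_closed_set_def)
  ultimately show ?thesis unfolding closedin_def op by metis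
qed


section \<open>Localization\<close>

text \<open>If \<open>A\<close> is a subring of the domain and \<open>S\<close> a multiplicative subset not containing 0, then the
  localization of \<open>A\<close> at \<open>S\<close> is this subring of the field of fractions. If \<open>0 \<in> S\<close>, the fractions
  \<open>Fract a 0 = 0\<close> are junk; below, \<open>S\<close> is always the complement of a prime ideal.\<close>

definition localization :: "'a::idom set \<Rightarrow> 'a set \<Rightarrow> 'a fract set"
  where "localization A S = {Fract a s | a s. a \<in> A \<and> s \<in> S}"

definition fraction_field :: "'a::idom set \<Rightarrow> 'a fract set"
  where "fraction_field A = localization A (A - {0})"


section \<open>Integral extensions and integral degree\<close>

definition monic_root :: "'a::idom set \<Rightarrow> 'a \<Rightarrow> nat \<Rightarrow> bool"
  where "monic_root A b n \<longleftrightarrow> (\<exists>p :: 'a poly. (\<forall>i. Polynomial.coeff p i \<in> A) \<and>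
    Polynomial.degree p = n \<and> Polynomial.coeff p n = 1 \<and> poly p b = 0)"

definition integral_over :: "'a::idom set \<Rightarrow> 'a \<Rightarrow> bool"
  where "integral_over A b \<longleftrightarrow> (\<exists>n. monic_root A b n)"

definition integral_extension :: "'a::idom set \<Rightarrow> 'a set \<Rightarrow> bool"
  where "integral_extension A B \<longleftrightarrow> ring_extension A B \<and> (\<forall>b\<in>B. integral_over A b)"

text \<open>Meaningful only for \<open>b\<close> integral over \<open>A\<close>.\<close>

definition elem_integral_degree :: "'a::idom set \<Rightarrow> 'a \<Rightarrow> nat"
  where "elem_integral_degree A b = (LEAST n. n \<ge> 1 \<and> monic_root A b n)"

definition integral_degree :: "'a::idom set \<Rightarrow> 'a set \<Rightarrow> enat"
  where "integral_degree A B = (SUP b\<in>B. enat (elem_integral_degree A b))"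

definition local_integral_degree :: "'a::idom set \<Rightarrow> 'a set \<Rightarrow> 'a set \<Rightarrow> enat"
  where "local_integral_degree A B P =
    integral_degree (localization A (A - P)) (localization B (A - P))"


section \<open>Finite integral closure\<close>

definition integral_closure :: "'a::idom set \<Rightarrow> 'a set \<Rightarrow> 'a set"
  where "integral_closure A K = {x \<in> K. integral_over A x}"

definition finitely_generated_module :: "'a::idom set \<Rightarrow> 'a set \<Rightarrow> bool"
  where "finitely_generated_module A M \<longleftrightarrow>
    (\<exists>G\<subseteq>M. finite G \<and> M = {\<Sum>g\<in>G. c g * g | c. c ` G \<subseteq> A})"

definition finite_integral_closure :: "'a::idom set \<Rightarrow> bool"
  where "finite_integral_closure A \<longleftrightarrow>
    finitely_generated_module (to_fract ` A) (integral_closure (to_fract ` A) (fraction_field A))"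


section \<open>Upper-semicontinuity\<close>

definition upper_semicontinuous_Spec :: "'a::idom set \<Rightarrow> ('a set \<Rightarrow> enat) \<Rightarrow> bool"
  where "upper_semicontinuous_Spec A d \<longleftrightarrow>
    (\<forall>n::nat. n \<ge> 1 \<longrightarrow> closedin (zariski A) {P \<in> Spec A. d P \<ge> enat n})"

end

theory Submission
  imports Defs "Jordan_Normal_Form.Char_Poly"
begin

text \<open>Write \<open>d\<close> for the local integral degree. An element of \<open>B\<close> satisfies over \<open>Frac A\<close> any
  monic equation that it satisfies over \<open>A\<^sub>P\<close>, so \<open>d(0) \<le> d(P)\<close> for all \<open>P\<close>. Since the integral
  closure of \<open>A\<close> is finite, a nonzero \<open>c \<in> A\<close> multiplies it into \<open>A\<close>; if \<open>c \<notin> P\<close> then \<open>A\<^sub>P\<close> is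
  integrally closed, minimal polynomials over \<open>Frac A\<close> of integral elements have coefficients in
  \<open>A\<^sub>P\<close>, and \<open>d(P) = d(0)\<close>. Hence \<open>{P. d(P) \<ge> n}\<close> is all of \<open>Spec A\<close>, or is contained in the
  set of primes containing \<open>c\<close>, which in a one-dimensional noetherian domain is a finite set of
  maximal ideals.\<close>

section \<open>Integral elements\<close>

text \<open>Multiply the relation by \<open>t ^ n\<close> and split
  \<open>t ^ n = t ^ (n - i) * t ^ i\<close> in the term of index \<open>i\<close>. Since
  \<open>i < n\<close>, each new coefficient keeps at least one factor \<open>t\<close>, which is
  what clears denominators later.\<close>

lemma scale_monic_relation:
  fixes b t :: "'a::comm_ring_1"
  assumes "b ^ n = (\<Sum>i<n. c i * b ^ i)"
  shows "(t * b) ^ n = (\<Sum>i<n. (t ^ (n - i) * c i) * (t * b) ^ i)"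
proof -
  have "(t * b) ^ n = (\<Sum>i<n. t ^ n * (c i * b ^ i))"
    by (simp add: power_mult_distrib assms sum_distrib_left)
  also have "\<dots> = (\<Sum>i<n. (t ^ (n - i) * c i) * (t * b) ^ i)"
  proof (intro sum.cong refl)
    fix i assume "i \<in> {..<n}"
    then have "t ^ n = t ^ (n - i) * t ^ i" by (simp flip: power_add)
    then show "t ^ n * (c i * b ^ i) = (t ^ (n - i) * c i) * (t * b) ^ i"
      by (simp add: power_mult_distrib mult_ac)
  qed
  finally show ?thesis .
qed

section \<open>Subrings in terms of the type class operations\<close>

locale type_subring =
  fixes R :: "'a::idom set"
  assumes one_mem: "1 \<in> R"
    and add_mem: "x \<in> R \<Longrightarrow> y \<in> R \<Longrightarrow> x + y \<in> R"
    and mult_mem: "x \<in> R \<Longrightarrow> y \<in> R \<Longrightarrow> x * y \<in> R"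
    and uminus_mem: "x \<in> R \<Longrightarrow> - x \<in> R"
begin

lemma zero_mem: "0 \<in> R"
  using add_mem[OF one_mem uminus_mem[OF one_mem]] by simp

lemma diff_mem: "x \<in> R \<Longrightarrow> y \<in> R \<Longrightarrow> x - y \<in> R"
  using add_mem[of x "- y"] uminus_mem[of y] by simp

lemma sum_mem: "(\<And>i. i \<in> I \<Longrightarrow> f i \<in> R) \<Longrightarrow> sum f I \<in> R"
  by (induction I rule: infinite_finite_induct) (auto simp: zero_mem add_mem)

lemma prod_mem: "(\<And>i. i \<in> I \<Longrightarrow> f i \<in> R) \<Longrightarrow> prod f I \<in> R"
  by (induction I rule: infinite_finite_induct) (auto simp: one_mem mult_mem)

lemma prod_mset_mem: "(\<And>i. i \<in># I \<Longrightarrow> f i \<in> R) \<Longrightarrow> prod_mset (image_mset f I) \<in> R"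
  by (induction I) (auto simp: one_mem mult_mem)

lemma power_mem: "x \<in> R \<Longrightarrow> x ^ n \<in> R"
  by (induction n) (auto simp: one_mem mult_mem)

end

lemma type_subring_of_subring:
  assumes "subring R (ring_of_type_algebra :: 'a::idom ring)"
  shows "type_subring R"
proof -
  interpret ring "ring_of_type_algebra :: 'a ring" by (rule ring_from_type_algebra)
  have "- x \<in> R" if "x \<in> R" for x
  proof -
    \<comment> \<open>The negation of the record is a definite description; uniqueness of additive
      inverses identifies it.\<close>
    have "\<ominus>\<^bsub>ring_of_type_algebra\<^esub> x = - x"
      by (intro minus_equality) (auto simp: ring_of_type_algebra_def)
    then show ?thesis using subringE(5)[OF assms that] by simp
  qed
  then show ?thesis
    using subringE(3)[OF assms] subringE(6,7)[OF assms]
    by unfold_locales (auto simp: ring_of_type_algebra_def)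
qed

section \<open>The polynomial ring R[T] inside the polynomials of the type\<close>

definition polys_on :: "'a::idom set \<Rightarrow> 'a poly set"
  where "polys_on R = {p. \<forall>i. coeff p i \<in> R}"

lemma coeff_mem: "p \<in> polys_on R \<Longrightarrow> coeff p i \<in> R"
  by (simp add: polys_on_def)

context type_subring
begin

lemma const_mem_polys_on: "c \<in> R \<Longrightarrow> [:c:] \<in> polys_on R"
  by (auto simp: polys_on_def coeff_pCons zero_mem split: nat.split)

lemma linear_mem_polys_on: "c \<in> R \<Longrightarrow> [:c, 1:] \<in> polys_on R"
  by (auto simp: polys_on_def coeff_pCons zero_mem one_mem split: nat.split)

lemma monom_mem_polys_on: "c \<in> R \<Longrightarrow> monom c n \<in> polys_on R"
  by (auto simp: polys_on_def zero_mem)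

lemma type_subring_polys_on: "type_subring (polys_on R)"
proof
  show "1 \<in> polys_on R"
    using const_mem_polys_on[OF one_mem] by (simp add: one_pCons)
qed (auto simp: polys_on_def coeff_mult intro!: add_mem uminus_mem sum_mem mult_mem)

text \<open>Moving the lower terms of a monic polynomial to the other side trades it for a
  coefficient function constrained only below \<open>n\<close>, a form that is easy to scale and to
  transport along homomorphisms.\<close>

lemma monic_root_iff:
  "monic_root R b n \<longleftrightarrow> (\<exists>c. (\<forall>i<n. c i \<in> R) \<and> b ^ n = (\<Sum>i<n. c i * b ^ i))"
proof
  assume "monic_root R b n"
  then obtain p where p: "\<And>i. coeff p i \<in> R" "degree p = n" "coeff p n = 1" "poly p b = 0"
    unfolding monic_root_def by blast
  have "poly p b = (\<Sum>i<n. coeff p i * b ^ i) + b ^ n"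
    unfolding poly_altdef p(2) by (simp add: p(3) flip: lessThan_Suc_atMost)
  then have "b ^ n = (\<Sum>i<n. - coeff p i * b ^ i)"
    using p(4) by (simp add: sum_negf eq_neg_iff_add_eq_0 add.commute)
  then show "\<exists>c. (\<forall>i<n. c i \<in> R) \<and> b ^ n = (\<Sum>i<n. c i * b ^ i)"
    using p(1) by (intro exI[of _ "\<lambda>i. - coeff p i"]) (auto intro: uminus_mem)
next
  assume "\<exists>c. (\<forall>i<n. c i \<in> R) \<and> b ^ n = (\<Sum>i<n. c i * b ^ i)"
  then obtain c where c: "\<And>i. i < n \<Longrightarrow> c i \<in> R" "b ^ n = (\<Sum>i<n. c i * b ^ i)" by blast
  interpret P: type_subring "polys_on R" by (rule type_subring_polys_on)
  \<comment> \<open>The monic polynomial sought is T^n - \<open>q\<close>.\<close>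
  define q where "q = (\<Sum>i<n. monom (c i) i)"
  have q: "q \<in> polys_on R"
    unfolding q_def using c by (intro P.sum_mem monom_mem_polys_on) auto
  have co: "coeff q i = 0" if "i \<ge> n" for i
    unfolding q_def coeff_sum using that by (intro sum.neutral) auto
  have cn: "coeff (monom 1 n - q) n = 1" by (simp add: co)
  have "degree (monom 1 n - q) \<le> n" by (intro degree_le) (auto simp: co)
  then have "degree (monom 1 n - q) = n"
    using le_degree[of "monom 1 n - q" n] cn by simp
  moreover have "poly (monom 1 n - q) b = 0"
    unfolding q_def using c(2) by (simp add: poly_sum poly_monom)
  moreover have "monom 1 n - q \<in> polys_on R"
    by (intro P.diff_mem q monom_mem_polys_on one_mem)
  ultimately show "monic_root R b n"
    unfolding monic_root_def using cn coeff_mem by blast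
qed

lemma monic_root_scale:
  assumes "monic_root R b n" "t \<in> R"
  shows "monic_root R (t * b) n"
proof -
  obtain c where c: "\<forall>i<n. c i \<in> R" "b ^ n = (\<Sum>i<n. c i * b ^ i)"
    using assms(1) by (auto simp: monic_root_iff)
  then show ?thesis
    unfolding monic_root_iff using scale_monic_relation[OF c(2), of t] assms(2)
    by (intro exI[of _ "\<lambda>i. t ^ (n - i) * c i"]) (auto intro: mult_mem power_mem)
qed

text \<open>In degree 0 the relation would read 1 = 0.\<close>

lemma monic_root_pos: "monic_root R b n \<Longrightarrow> n \<ge> 1"
  by (cases n) (auto simp: monic_root_iff)

end

lemma monic_root_mono: "R \<subseteq> S \<Longrightarrow> monic_root R b n \<Longrightarrow> monic_root S b n"
  unfolding monic_root_def by blast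

text \<open>By the Leibniz formula the determinant is a sum of signed products of entries of the
  characteristic matrix, and these entries lie in R[T].\<close>

lemma char_poly_mem_polys_on:
  assumes "type_subring R" "C \<in> carrier_mat n n" "\<And>i j. i < n \<Longrightarrow> j < n \<Longrightarrow> C $$ (i, j) \<in> R"
  shows "char_poly C \<in> polys_on R"
proof -
  interpret type_subring R by fact
  interpret P: type_subring "polys_on R" by (rule type_subring_polys_on)
  have "char_poly_matrix C $$ (i, j) \<in> polys_on R" if "i < n" "j < n" for i j
  proof -
    have "char_poly_matrix C $$ (i, j) = (if i = j then [:0, 1:] else 0) + [:- (C $$ (i, j)):]"
      using that assms(2) by (auto simp: char_poly_matrix_def)
    also have "\<dots> \<in> polys_on R"
      using that assms(3)
      by (intro P.add_mem const_mem_polys_on uminus_mem)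
        (auto intro: linear_mem_polys_on zero_mem P.zero_mem)
    finally show ?thesis .
  qed
  moreover have "signof p \<in> polys_on R" for p :: "nat \<Rightarrow> nat"
    by (auto simp: sign_def intro: P.one_mem P.uminus_mem)
  moreover have "p i < n" if "p permutes {0..<n}" "i < n" for p i
    using permutes_in_image[OF that(1), of i] that(2) by simp
  ultimately show ?thesis
    unfolding char_poly_def det_def'[OF char_poly_matrix_closed[OF assms(2)]]
    by (intro P.sum_mem P.mult_mem P.prod_mem) auto
qed

section \<open>Finitely generated modules and integral elements\<close>

definition span_on :: "'a::idom set \<Rightarrow> 'a set \<Rightarrow> 'a set"
  where "span_on R G = {\<Sum>g\<in>G. c g * g | c. c ` G \<subseteq> R}"

text \<open>The coefficient matrix of multiplication by \<open>u\<close> on \<open>G\<close> has eigenvalue \<open>u\<close>.\<close>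

lemma integral_over_if_stabilizes_span:
  fixes R :: "'a::field set"
  assumes "type_subring R" "finite G" "h \<in> G" "h \<noteq> 0"
    and stab: "\<And>g. g \<in> G \<Longrightarrow> u * g \<in> span_on R G"
  shows "integral_over R u"
proof -
  obtain xs where xs: "set xs = G" "distinct xs" using finite_distinct_list[OF assms(2)] by blast
  define n where "n = length xs"
  have "\<forall>g\<in>G. \<exists>c. c ` G \<subseteq> R \<and> u * g = (\<Sum>g\<in>G. c g * g)"
    using stab unfolding span_on_def by blast
  then obtain c where c: "\<And>g. g \<in> G \<Longrightarrow> c g ` G \<subseteq> R" "\<And>g. g \<in> G \<Longrightarrow> u * g = (\<Sum>h\<in>G. c g h * h)"
    by metis
  define C where "C = mat n n (\<lambda>(i, j). c (xs ! i) (xs ! j))"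
  define v where "v = vec n (\<lambda>i. xs ! i)"
  have C: "C \<in> carrier_mat n n" by (simp add: C_def)
  have "C *\<^sub>v v = u \<cdot>\<^sub>v v"
  proof (rule eq_vecI)
    fix i assume "i < dim_vec (u \<cdot>\<^sub>v v)"
    then have i: "i < n" by (simp add: v_def)
    have "(\<Sum>h\<in>G. c (xs ! i) h * h) = (\<Sum>j = 0..<n. c (xs ! i) (xs ! j) * xs ! j)"
      unfolding xs(1)[symmetric] n_def
      using sum.reindex_bij_betw[OF bij_betw_nth[OF xs(2) refl refl], of "\<lambda>h. c (xs ! i) h * h"]
      by (simp add: atLeast0LessThan)
    then show "(C *\<^sub>v v) $ i = (u \<cdot>\<^sub>v v) $ i"
      using i c(2)[of "xs ! i"] nth_mem[of i xs] xs(1)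
      by (simp add: C_def v_def scalar_prod_def n_def)
  qed (simp add: C_def v_def)
  moreover have "v \<noteq> 0\<^sub>v n"
  proof
    assume v0: "v = 0\<^sub>v n"
    obtain i where "i < n" "xs ! i = h" using assms(3) xs(1) by (auto simp: in_set_conv_nth n_def)
    with v0 have "h = 0" by (auto simp: v_def vec_eq_iff)
    with assms(4) show False by simp
  qed
  ultimately have "eigenvalue C u"
    unfolding eigenvalue_def eigenvector_def using C by (auto intro!: exI[of _ v] simp: v_def)
  then have "poly (char_poly C) u = 0" using eigenvalue_root_char_poly[OF C] by blast
  moreover have "char_poly C \<in> polys_on R"
    using c(1) xs(1) nth_mem[of _ xs]
    by (intro char_poly_mem_polys_on[OF assms(1) C]) (simp add: C_def n_def image_subset_iff)
  ultimately have "monic_root R u n"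
    unfolding monic_root_def using degree_monic_char_poly[OF C] coeff_mem by blast
  then show ?thesis unfolding integral_over_def by blast
qed

context type_subring
begin

lemma span_on_add: "x \<in> span_on R G \<Longrightarrow> y \<in> span_on R G \<Longrightarrow> x + y \<in> span_on R G"
proof -
  assume "x \<in> span_on R G" "y \<in> span_on R G"
  then obtain c d where "c ` G \<subseteq> R" "d ` G \<subseteq> R" "x = (\<Sum>g\<in>G. c g * g)" "y = (\<Sum>g\<in>G. d g * g)"
    unfolding span_on_def by blast
  then show "x + y \<in> span_on R G"
    unfolding span_on_def
    by (auto intro!: exI[of _ "\<lambda>g. c g + d g"] add_mem simp: sum.distrib algebra_simps)
qed

lemma span_on_scale: "r \<in> R \<Longrightarrow> x \<in> span_on R G \<Longrightarrow> r * x \<in> span_on R G"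
proof -
  assume r: "r \<in> R" and "x \<in> span_on R G"
  then obtain c where "c ` G \<subseteq> R" "x = (\<Sum>g\<in>G. c g * g)"
    unfolding span_on_def by blast
  with r show "r * x \<in> span_on R G"
    unfolding span_on_def
    by (auto intro!: exI[of _ "\<lambda>g. r * c g"] mult_mem simp: sum_distrib_left algebra_simps)
qed

lemma span_on_zero: "0 \<in> span_on R G"
  unfolding span_on_def by (auto intro!: exI[of _ "\<lambda>_. 0"] zero_mem)

lemma span_on_superset: "finite G \<Longrightarrow> g \<in> G \<Longrightarrow> g \<in> span_on R G"
  unfolding span_on_def
  by (auto intro!: exI[of _ "\<lambda>h. if h = g then 1 else 0"] zero_mem one_mem simp: if_distrib if_distribR
      cong: if_cong)

lemma span_on_sum: "(\<And>i. i \<in> I \<Longrightarrow> f i \<in> span_on R G) \<Longrightarrow> sum f I \<in> span_on R G"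
  by (induction I rule: infinite_finite_induct) (auto simp: span_on_zero span_on_add)

text \<open>Multiplication by \<open>y\<close> is linear, so it is enough to control it on
  generators.\<close>

lemma mult_span_on_subset:
  assumes "\<And>g. g \<in> G \<Longrightarrow> y * g \<in> span_on R H" "x \<in> span_on R G"
  shows "y * x \<in> span_on R H"
proof -
  obtain c where c: "c ` G \<subseteq> R" "x = (\<Sum>g\<in>G. c g * g)" using assms(2) unfolding span_on_def by blast
  have "y * x = (\<Sum>g\<in>G. c g * (y * g))" by (simp add: c(2) sum_distrib_left algebra_simps)
  also have "\<dots> \<in> span_on R H"
  proof (rule span_on_sum)
    show "c g * (y * g) \<in> span_on R H" if "g \<in> G" for g
      using that c(1) by (intro span_on_scale[of "c g"] assms(1)) auto
  qed
  finally show ?thesis .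
qed

text \<open>Induction on \<open>T\<close>: if \<open>G\<close> works for \<open>T\<close> and
  \<open>b\<close> has a monic equation of degree \<open>n\<close>, the products
  \<open>b ^ k * g\<close> with \<open>k < n\<close> and \<open>g \<in> G\<close> work for
  \<open>insert b T\<close>. The nonzero generator is what later makes an eigenvector
  nonzero.\<close>

lemma finite_stabilized_span:
  assumes "finite T" "\<And>x. x \<in> T \<Longrightarrow> integral_over R x"
  shows "\<exists>G h. finite G \<and> h \<in> G \<and> h \<noteq> 0 \<and> (\<forall>x\<in>T. \<forall>g\<in>G. x * g \<in> span_on R G)"
  using assms
proof (induction T)
  case empty
  show ?case by (intro exI[of _ "{1}"] exI[of _ 1]) auto
next
  case (insert b T)
  then obtain G h where G: "finite G" "h \<in> G" "h \<noteq> 0" "\<And>x g. x \<in> T \<Longrightarrow> g \<in> G \<Longrightarrow> x * g \<in> span_on R G"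
    by auto
  obtain n c where c: "n \<ge> 1" "\<forall>i<n. c i \<in> R" "b ^ n = (\<Sum>i<n. c i * b ^ i)"
    using insert.prems[of b] monic_root_pos unfolding integral_over_def monic_root_iff by blast
  define H where "H = (\<lambda>(k, g). b ^ k * g) ` ({..<n} \<times> G)"
  have H: "b ^ k * g \<in> H" if "k < n" "g \<in> G" for k g
    unfolding H_def using that by (intro image_eqI[of _ _ "(k, g)"]) auto
  have fin: "finite H" unfolding H_def using G(1) by simp
  have bH: "b * x \<in> span_on R H" if "x \<in> H" for x
  proof -
    obtain k g where kg: "k < n" "g \<in> G" "x = b ^ k * g" using \<open>x \<in> H\<close> by (auto simp: H_def)
    show ?thesis
    proof (cases "Suc k < n")
      case True
      then show ?thesis using kg H[of "Suc k" g] span_on_superset[OF fin] by (simp add: mult.assoc)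
    next
      \<comment> \<open>At the top exponent the product leaves the list of generators, and the monic
        equation of \<open>b\<close> brings it back into their span.\<close>
      case False
      then have "n = Suc k" using kg by simp
      then have "b * x = b ^ n * g" using kg by simp
      also have "\<dots> = (\<Sum>i<n. c i * (b ^ i * g))"
        by (simp add: c(3) sum_distrib_right mult.assoc)
      also have "\<dots> \<in> span_on R H"
        using c(2) kg H by (intro span_on_sum span_on_scale span_on_superset fin) auto
      finally show ?thesis .
    qed
  qed
  have TH: "x * y \<in> span_on R H" if "x \<in> T" "y \<in> H" for x y
  proof -
    obtain k g where kg: "k < n" "g \<in> G" "y = b ^ k * g" using \<open>y \<in> H\<close> by (auto simp: H_def)
    \<comment> \<open>\<open>x * g\<close> is a combination of elements of \<open>G\<close>, and
      \<open>b ^ k\<close> carries these into \<open>H\<close>.\<close>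
    have "b ^ k * (x * g) \<in> span_on R H"
      by (rule mult_span_on_subset[OF _ G(4)[OF \<open>x \<in> T\<close> kg(2)]])
        (use kg H span_on_superset[OF fin] in auto)
    then show ?thesis by (simp add: kg algebra_simps)
  qed
  \<comment> \<open>The exponent 0 is available because \<open>n \<ge> 1\<close>.\<close>
  have "h \<in> H" using H[of 0 h] c(1) G(2) by simp
  then show ?case using fin G(3) bH TH by blast
qed

end

text \<open>\<open>S\<close> is the stabilizer of a finitely generated module on which all elements of \<open>T\<close> act.\<close>

lemma integral_subring_exists:
  fixes R :: "'a::field set"
  assumes "type_subring R" "finite T" "\<And>x. x \<in> T \<Longrightarrow> integral_over R x"
  obtains S where "type_subring S" "T \<subseteq> S" "\<And>s. s \<in> S \<Longrightarrow> integral_over R s"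
proof -
  interpret type_subring R by fact
  obtain G h where G: "finite G" "h \<in> G" "h \<noteq> 0" "\<And>x g. x \<in> T \<Longrightarrow> g \<in> G \<Longrightarrow> x * g \<in> span_on R G"
    using finite_stabilized_span[OF assms(2,3)] by blast
  define S where "S = {y. \<forall>g\<in>G. y * g \<in> span_on R G}"
  have "type_subring S"
  proof
    show "1 \<in> S" by (simp add: S_def span_on_superset G)
    fix x assume x: "x \<in> S"
    then show "- x \<in> S"
      using span_on_scale[OF uminus_mem[OF one_mem]] by (fastforce simp: S_def)
    fix y assume y: "y \<in> S"
    show "x + y \<in> S" using x y span_on_add by (simp add: S_def distrib_right)
    show "x * y \<in> S" using x y mult_span_on_subset[of G x G] by (simp add: S_def mult.assoc)
  qed
  moreover have "T \<subseteq> S" using G(4) by (auto simp: S_def)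
  moreover have "integral_over R s" if "s \<in> S" for s
    using that by (intro integral_over_if_stabilizes_span[OF assms(1) G(1-3)]) (simp add: S_def)
  ultimately show ?thesis using that by blast
qed

text \<open>Division with remainder by a monic polynomial: subtracting a monomial multiple of
  \<open>g\<close> cancels the leading term, which lowers the degree until it is below
  \<open>m\<close>.\<close>

lemma polys_on_reduce:
  assumes "type_subring K" "g \<in> polys_on K" "degree g = m" "coeff g m = 1" "m \<ge> 1" "f \<in> polys_on K"
  shows "\<exists>q. f - q * g \<in> polys_on K \<and> degree (f - q * g) < m"
  using assms(6)
proof (induction "degree f" arbitrary: f rule: less_induct)
  case less
  interpret type_subring K by fact
  interpret P: type_subring "polys_on K" by (rule type_subring_polys_on)
  show ?case
  proof (cases "degree f < m")
    case True
    then show ?thesis using less.prems by (intro exI[of _ 0]) simp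
  next
    case False
    define t where "t = monom (lead_coeff f) (degree f - m)"
    have deg: "degree (t * g) \<le> degree f"
      using False assms(3) degree_mult_le[of t g] degree_monom_le[of "lead_coeff f" "degree f - m"]
      by (simp add: t_def)
    have "coeff (t * g) (degree f) = lead_coeff f"
      using False assms(4) by (simp add: t_def coeff_monom_mult)
    then have "coeff (f - t * g) (degree f) = 0" by simp
    moreover have "degree (f - t * g) \<le> degree f" by (intro degree_diff_le deg order.refl)
    \<comment> \<open>Were the degrees equal, the leading coefficient would vanish, so the
      difference would be 0 and \<open>degree f\<close> would be 0, contrary to
      \<open>degree f \<ge> m \<ge> 1\<close>.\<close>
    ultimately have "degree (f - t * g) < degree f"
      using False assms(5)
      by (metis degree_0 le_neq_implies_less leading_coeff_0_iff less_le_trans less_one not_le)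
    moreover have "f - t * g \<in> polys_on K"
      using less.prems assms(2) by (intro P.diff_mem P.mult_mem)
          (auto simp: t_def intro: monom_mem_polys_on coeff_mem)
    ultimately obtain q where "f - t * g - q * g \<in> polys_on K" "degree (f - t * g - q * g) < m"
      using less.hyps by blast
    moreover have "f - (t + q) * g = f - t * g - q * g" by (simp add: algebra_simps)
    ultimately show ?thesis by (metis (no_types))
  qed
qed

section \<open>Transport of integral relations along homomorphisms\<close>

lemma type_subring_image:
  fixes h :: "'a::idom \<Rightarrow> 'b::idom"
  assumes "comm_ring_hom h" "type_subring R"
  shows "type_subring (h ` R)"
proof -
  interpret comm_ring_hom h by fact
  interpret type_subring R by fact
  show ?thesis
  proof
    show "1 \<in> h ` R" using one_mem by (intro image_eqI[of _ _ 1]) simp_all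
    fix x assume "x \<in> h ` R"
    then obtain a where a: "a \<in> R" "x = h a" by blast
    then show "- x \<in> h ` R" using uminus_mem by (intro image_eqI[of _ _ "- a"]) (simp_all add: hom_uminus)
    fix y assume "y \<in> h ` R"
    then obtain b where b: "b \<in> R" "y = h b" by blast
    show "x + y \<in> h ` R" using a b add_mem by (intro image_eqI[of _ _ "a + b"]) (simp_all add: hom_add)
    show "x * y \<in> h ` R" using a b mult_mem by (intro image_eqI[of _ _ "a * b"]) (simp_all add: hom_mult)
  qed
qed

text \<open>Coefficients in the image lift to \<open>R\<close>, and injectivity reflects the
  relation between them.\<close>

lemma monic_root_image_iff:
  fixes h :: "'a::idom \<Rightarrow> 'b::idom"
  assumes "inj_comm_ring_hom h" "type_subring R"
  shows "monic_root (h ` R) (h b) n \<longleftrightarrow> monic_root R b n"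
proof -
  interpret inj_comm_ring_hom h by fact
  interpret R: type_subring R by fact
  interpret I: type_subring "h ` R"
    by (rule type_subring_image[OF comm_ring_hom_axioms assms(2)])
  have eq: "h b ^ n = (\<Sum>i<n. h (c i) * h b ^ i) \<longleftrightarrow> b ^ n = (\<Sum>i<n. c i * b ^ i)" for c
    unfolding eq_iff[of "b ^ n", symmetric] hom_sum hom_mult hom_power ..
  show ?thesis
  proof
    assume "monic_root (h ` R) (h b) n"
    then obtain d where d: "\<forall>i<n. d i \<in> h ` R" "h b ^ n = (\<Sum>i<n. d i * h b ^ i)"
      unfolding I.monic_root_iff by blast
    then have "\<forall>i. \<exists>a. i < n \<longrightarrow> a \<in> R \<and> d i = h a" by blast
    then obtain c where c: "\<And>i. i < n \<Longrightarrow> c i \<in> R \<and> d i = h (c i)" by metis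
    then have "b ^ n = (\<Sum>i<n. c i * b ^ i)" using d(2) by (simp flip: eq)
    then show "monic_root R b n" unfolding R.monic_root_iff using c by blast
  next
    assume "monic_root R b n"
    then obtain c where c: "\<forall>i<n. c i \<in> R" "b ^ n = (\<Sum>i<n. c i * b ^ i)"
      unfolding R.monic_root_iff by blast
    then show "monic_root (h ` R) (h b) n"
      unfolding I.monic_root_iff by (intro exI[of _ "\<lambda>i. h (c i)"]) (simp add: eq)
  qed
qed

lemma integral_over_image_iff:
  fixes h :: "'a::idom \<Rightarrow> 'b::idom"
  assumes "inj_comm_ring_hom h" "type_subring R"
  shows "integral_over (h ` R) (h b) \<longleftrightarrow> integral_over R b"
  unfolding integral_over_def monic_root_image_iff[OF assms] ..

lemma inj_comm_ring_hom_to_ac: "inj_comm_ring_hom to_ac"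
  by unfold_locales auto

lemma inj_comm_ring_hom_to_fract: "inj_comm_ring_hom to_fract"
  by unfold_locales auto

text \<open>In the algebraic closure \<open>g\<close> splits into linear factors whose roots are roots of \<open>f\<close>, so its
  coefficients lie in a subring of integral elements.\<close>

lemma monic_factor_coeffs_integral:
  fixes f g :: "'a::field poly"
  assumes "type_subring R" "f \<in> polys_on R" "lead_coeff f = 1" "g dvd f" "lead_coeff g = 1"
  shows "integral_over R (coeff g i)"
proof -
  interpret h: inj_comm_ring_hom "to_ac :: 'a \<Rightarrow> _" by (rule inj_comm_ring_hom_to_ac)
  interpret hp: map_poly_inj_comm_ring_hom "to_ac :: 'a \<Rightarrow> _" ..
  interpret I: type_subring "to_ac ` R"
    by (rule type_subring_image[OF h.comm_ring_hom_axioms assms(1)])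
  let ?f = "map_poly to_ac f" and ?g = "map_poly to_ac g"
  have "g \<noteq> 0" using assms(5) by auto
  then obtain Z where Z: "?g = (\<Prod>z\<in>#Z. [:- z, 1:])"
    using alg_closed_imp_factorization[of ?g] assms(5) by auto
  have "integral_over (to_ac ` R) z" if "z \<in># Z" for z
  proof -
    have "[:- z, 1:] dvd ?g" unfolding Z using that by (intro dvd_prod_mset) auto
    also have "?g dvd ?f" using assms(4) by (rule hp.hom_dvd)
    finally have "poly ?f z = 0" by (simp add: poly_eq_0_iff_dvd)
    then show ?thesis
      unfolding integral_over_def monic_root_def using assms(2,3)
      by (intro exI[of _ "degree f"] exI[of _ ?f]) (auto simp: coeff_mem)
  qed
  then obtain T where T: "type_subring T" "set_mset Z \<subseteq> T" "\<And>s. s \<in> T \<Longrightarrow> integral_over (to_ac ` R) s"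
    using integral_subring_exists[OF I.type_subring_axioms, of "set_mset Z"] by auto
  interpret T: type_subring T by fact
  interpret P: type_subring "polys_on T" by (rule T.type_subring_polys_on)
  have "?g \<in> polys_on T"
    unfolding Z using T(2) by (intro P.prod_mset_mem T.linear_mem_polys_on T.uminus_mem) auto
  then have "integral_over (to_ac ` R) (coeff ?g i)" using T(3) coeff_mem by blast
  then show ?thesis
    by (simp add: integral_over_image_iff[OF inj_comm_ring_hom_to_ac assms(1)])
qed

text \<open>The remainder of \<open>f\<close> modulo \<open>g\<close> also vanishes at
  \<open>x\<close>. If it were nonzero, dividing it by its leading coefficient would give a monic
  equation over \<open>K\<close> of degree smaller than that of \<open>g\<close>.\<close>

lemma minimal_monic_dvd:
  fixes K :: "'a::field set"
  assumes "type_subring K" "\<And>x. x \<in> K \<Longrightarrow> inverse x \<in> K"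
    and g: "g \<in> polys_on K" "lead_coeff g = 1" "poly g x = 0"
    and minimal: "\<And>k. monic_root K x k \<Longrightarrow> degree g \<le> k"
    and f: "f \<in> polys_on K" "poly f x = 0"
  shows "g dvd f"
proof -
  interpret type_subring K by fact
  interpret P: type_subring "polys_on K" by (rule type_subring_polys_on)
  have "monic_root K x (degree g)" unfolding monic_root_def using g coeff_mem by blast
  then obtain q where q: "f - q * g \<in> polys_on K" "degree (f - q * g) < degree g"
    using polys_on_reduce[OF assms(1) g(1) refl g(2) monic_root_pos f(1)] by blast
  define r where "r = f - q * g"
  have r: "r \<in> polys_on K" using q(1) by (simp add: r_def)
  have "r = 0"
  proof (rule ccontr)
    assume "r \<noteq> 0"
    define r' where "r' = smult (inverse (lead_coeff r)) r"
    have "[:inverse (lead_coeff r):] * r \<in> polys_on K"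
      using r coeff_mem by (intro P.mult_mem const_mem_polys_on assms(2))
    then have "r' \<in> polys_on K" by (simp add: r'_def)
    moreover have "poly r' x = 0" using f(2) g(3) by (simp add: r'_def r_def)
    moreover have "lead_coeff r' = 1" "degree r' = degree r" using \<open>r \<noteq> 0\<close> by (auto simp: r'_def)
    ultimately have "monic_root K x (degree r)"
      unfolding monic_root_def using coeff_mem by metis
    then show False using minimal[of "degree r"] q(2) by (simp add: r_def)
  qed
  then show ?thesis by (simp add: r_def)
qed

section \<open>Integral degrees of elements\<close>

lemma monic_root_elem_integral_degree:
  assumes "type_subring R" "integral_over R b"
  shows "monic_root R b (elem_integral_degree R b)"
proof -
  obtain n where "monic_root R b n" using assms(2) by (auto simp: integral_over_def)
  then have "n \<ge> 1 \<and> monic_root R b n" using type_subring.monic_root_pos[OF assms(1)] by blast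
  then show ?thesis unfolding elem_integral_degree_def by (rule LeastI2) simp
qed

lemma elem_integral_degree_le:
  assumes "type_subring R" "monic_root R b n"
  shows "elem_integral_degree R b \<le> n"
  using assms type_subring.monic_root_pos unfolding elem_integral_degree_def by (intro Least_le) blast

text \<open>\<open>K\<close> is a subfield in which \<open>R\<close> is integrally closed. The
  minimal polynomial of \<open>x\<close> over \<open>K\<close> divides a monic equation over
  \<open>R\<close>, so its coefficients are integral over \<open>R\<close> and hence lie in
  \<open>R\<close>; it is itself an equation over \<open>R\<close>.\<close>

lemma elem_integral_degree_le_fraction_field:
  fixes R K :: "'a::field set"
  assumes "type_subring R" "type_subring K" "R \<subseteq> K" "\<And>x. x \<in> K \<Longrightarrow> inverse x \<in> K"
    and normal: "\<And>u. u \<in> K \<Longrightarrow> integral_over R u \<Longrightarrow> u \<in> R"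
    and "integral_over R x"
  shows "elem_integral_degree R x \<le> elem_integral_degree K x"
proof -
  have "integral_over K x" using assms(3,6) monic_root_mono unfolding integral_over_def by blast
  then obtain g where g: "g \<in> polys_on K" "degree g = elem_integral_degree K x" "lead_coeff g = 1"
      "poly g x = 0"
    using monic_root_elem_integral_degree[OF assms(2)] unfolding monic_root_def polys_on_def by force
  obtain f where f: "f \<in> polys_on R" "lead_coeff f = 1" "poly f x = 0"
    using assms(6) unfolding integral_over_def monic_root_def polys_on_def by force
  have "f \<in> polys_on K" using f(1) assms(3) by (auto simp: polys_on_def)
  then have "g dvd f"
    using minimal_monic_dvd[OF assms(2,4) g(1,3,4)] f(3) g(2) elem_integral_degree_le[OF assms(2)]
    by simp
  then have "coeff g i \<in> R" for i
    using monic_factor_coeffs_integral[OF assms(1) f(1,2) _ g(3)] coeff_mem[OF g(1)]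
    by (intro normal) auto
  then have "monic_root R x (degree g)" unfolding monic_root_def using g(3,4) by blast
  then show ?thesis unfolding g(2) by (rule elem_integral_degree_le[OF assms(1)])
qed


section \<open>Localization\<close>

text \<open>Excluding 0 from \<open>S\<close> rules out junk fractions. The two instances used are
  the nonzero elements and the complement of a prime.\<close>

locale multiplicative_subset = type_subring A for A :: "'a::idom set" +
  fixes S :: "'a set"
  assumes S_subset: "S \<subseteq> A"
    and one_mem_S: "1 \<in> S"
    and mult_mem_S: "s \<in> S \<Longrightarrow> t \<in> S \<Longrightarrow> s * t \<in> S"
    and zero_notin_S: "0 \<notin> S"
begin

lemma to_fract_nonzero: "s \<in> S \<Longrightarrow> to_fract s \<noteq> 0"
  using zero_notin_S by auto

lemma localizationI: "a \<in> B \<Longrightarrow> s \<in> S \<Longrightarrow> to_fract a / to_fract s \<in> localization B S"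
  unfolding localization_def by (auto simp: Fract_conv_to_fract)

lemma localizationE:
  assumes "x \<in> localization B S"
  obtains a s where "a \<in> B" "s \<in> S" "x = to_fract a / to_fract s"
  using assms unfolding localization_def by (auto simp: Fract_conv_to_fract)

lemma to_fract_mem_localization: "a \<in> B \<Longrightarrow> to_fract a \<in> localization B S"
  using localizationI[OF _ one_mem_S] by simp

lemma type_subring_localization: "type_subring (localization A S)"
proof
  show "1 \<in> localization A S" using to_fract_mem_localization[OF one_mem] by simp
  fix x assume "x \<in> localization A S"
  then obtain a s where x: "a \<in> A" "s \<in> S" "x = to_fract a / to_fract s" by (rule localizationE)
  show "- x \<in> localization A S" using localizationI[OF uminus_mem[OF x(1)] x(2)] x(3) by simp
  fix y assume "y \<in> localization A S"
  then obtain b t where y: "b \<in> A" "t \<in> S" "y = to_fract b / to_fract t" by (rule localizationE)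
  have "x + y = to_fract (a * t + b * s) / to_fract (s * t)"
    using x y to_fract_nonzero by (simp add: field_simps)
  also have "\<dots> \<in> localization A S"
    using x y S_subset by (intro localizationI mult_mem_S add_mem mult_mem) auto
  finally show "x + y \<in> localization A S" .
  have "x * y = to_fract (a * b) / to_fract (s * t)" using x y by simp
  also have "\<dots> \<in> localization A S" using x y by (intro localizationI mult_mem_S mult_mem)
  finally show "x * y \<in> localization A S" .
qed

text \<open>The product of the denominators of the elements of \<open>G\<close>, built up by
  induction, works.\<close>

lemma common_denominator:
  assumes "finite G" "G \<subseteq> localization A S"
  shows "\<exists>s\<in>S. \<forall>g\<in>G. to_fract s * g \<in> to_fract ` A"
  using assms
proof (induction G)
  case empty
  then show ?case using one_mem_S by blast
next
  case (insert g G)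
  then obtain s where s: "s \<in> S" "\<And>x. x \<in> G \<Longrightarrow> to_fract s * x \<in> to_fract ` A" by auto
  obtain a t where g: "a \<in> A" "t \<in> S" "g = to_fract a / to_fract t"
    using insert.prems by (auto elim: localizationE)
  have "to_fract (s * t) * x \<in> to_fract ` A" if "x \<in> insert g G" for x
  proof (cases "x = g")
    case True
    then have "to_fract (s * t) * x = to_fract (s * a)" using g to_fract_nonzero by simp
    then show ?thesis using s(1) g(1) S_subset mult_mem by blast
  next
    case False
    then have "to_fract s * x \<in> to_fract ` A" using s(2) that by blast
    then obtain b where b: "b \<in> A" "to_fract s * x = to_fract b" by blast
    have "to_fract (s * t) * x = to_fract (t * b)" by (simp flip: b(2))
    then show ?thesis using b(1) g(2) S_subset mult_mem by blast
  qed
  then show ?case using mult_mem_S[OF s(1) g(2)] by blast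
qed

text \<open>Take \<open>s\<close> to be a common denominator of the coefficients of an equation for
  \<open>u\<close>, and scale the equation by \<open>s\<close>.\<close>

lemma clear_denominators:
  assumes "integral_over (localization A S) u"
  shows "\<exists>s\<in>S. integral_over (to_fract ` A) (to_fract s * u)"
proof -
  interpret L: type_subring "localization A S" by (rule type_subring_localization)
  interpret h: inj_comm_ring_hom "to_fract :: 'a \<Rightarrow> _" by (rule inj_comm_ring_hom_to_fract)
  interpret I: type_subring "to_fract ` A"
    by (rule type_subring_image[OF h.comm_ring_hom_axioms type_subring_axioms])
  obtain n c where c: "\<And>i. i < n \<Longrightarrow> c i \<in> localization A S" "u ^ n = (\<Sum>i<n. c i * u ^ i)"
    using assms unfolding integral_over_def L.monic_root_iff by blast
  have "c ` {..<n} \<subseteq> localization A S" using c(1) by blast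
  then obtain s where s: "s \<in> S" "\<And>i. i < n \<Longrightarrow> to_fract s * c i \<in> to_fract ` A"
    using common_denominator[of "c ` {..<n}"] by blast
  have "to_fract s ^ (n - i) * c i \<in> to_fract ` A" if "i < n" for i
  proof -
    \<comment> \<open>As \<open>i < n\<close>, one factor \<open>s\<close> can be spent on the
      denominator of \<open>c i\<close>.\<close>
    have "to_fract s ^ (n - i) * c i = to_fract s ^ (n - Suc i) * (to_fract s * c i)"
      using that by (simp add: Suc_diff_Suc flip: power_Suc2 mult.assoc)
    also have "\<dots> \<in> to_fract ` A"
      using s(1) S_subset by (intro I.mult_mem I.power_mem s(2)[OF that]) auto
    finally show ?thesis .
  qed
  then have "monic_root (to_fract ` A) (to_fract s * u) n"
    unfolding I.monic_root_iff using scale_monic_relation[OF c(2), of "to_fract s"]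
    by (intro exI[of _ "\<lambda>i. to_fract s ^ (n - i) * c i"]) simp
  then show ?thesis using s(1) unfolding integral_over_def by blast
qed

text \<open>An equation of the numerator over \<open>A\<close> is scaled by \<open>1 / s\<close>,
  which lies in the localization of \<open>A\<close>.\<close>

lemma integral_over_localization:
  assumes "\<forall>b\<in>B. integral_over A b" "x \<in> localization B S"
  shows "integral_over (localization A S) x"
proof -
  interpret L: type_subring "localization A S" by (rule type_subring_localization)
  obtain b s where x: "b \<in> B" "s \<in> S" "x = to_fract b / to_fract s"
    using assms(2) by (rule localizationE)
  obtain n where "monic_root A b n"
    using assms(1) x(1) unfolding integral_over_def by blast
  then have "monic_root (to_fract ` A) (to_fract b) n"
    by (simp add: monic_root_image_iff[OF inj_comm_ring_hom_to_fract type_subring_axioms])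
  moreover have "to_fract ` A \<subseteq> localization A S"
    using to_fract_mem_localization by blast
  ultimately have "monic_root (localization A S) (to_fract b) n"
    by (rule monic_root_mono[rotated])
  then have "monic_root (localization A S) (to_fract 1 / to_fract s * to_fract b) n"
    using localizationI[OF one_mem x(2)] by (intro L.monic_root_scale) auto
  then show ?thesis using x(3) unfolding integral_over_def by auto
qed

end

lemma (in type_subring) multiplicative_subset_nonzero: "multiplicative_subset R (R - {0})"
  by unfold_locales (auto simp: one_mem mult_mem)

lemma (in type_subring) multiplicative_subset_compl_prime:
  assumes "P \<in> Spec R"
  shows "multiplicative_subset R (R - P)"
proof -
  interpret primeideal P "ring_on R" using assms by (simp add: Spec_def)
  show ?thesis
  proof
    show "1 \<in> R - P"
      using one_mem one_imp_carrier I_notcarr by (auto simp: ring_of_type_algebra_def)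
    show "0 \<notin> R - P" 
      using additive_subgroup.zero_closed[OF is_additive_subgroup]
      by (simp add: ring_of_type_algebra_def)
    show "s * t \<in> R - P" if "s \<in> R - P" "t \<in> R - P" for s t
      using that mult_mem I_prime[of s t] by (auto simp: ring_of_type_algebra_def)
  qed auto
qed

text \<open>A common denominator of finitely many module generators of the integral closure
  multiplies the whole closure into \<open>R\<close>, by linearity; it is a nonzero element of the
  conductor.\<close>

lemma (in type_subring) conductor_nonzero:
  assumes "finite_integral_closure R"
  obtains c where "c \<in> R" "c \<noteq> 0"
    "\<And>y. y \<in> fraction_field R \<Longrightarrow> integral_over (to_fract ` R) y \<Longrightarrow> to_fract c * y \<in> to_fract ` R"
proof -
  interpret S: multiplicative_subset R "R - {0}" by (rule multiplicative_subset_nonzero)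
  interpret h: inj_comm_ring_hom "to_fract :: 'a \<Rightarrow> _" by (rule inj_comm_ring_hom_to_fract)
  interpret I: type_subring "to_fract ` R"
    by (rule type_subring_image[OF h.comm_ring_hom_axioms type_subring_axioms])
  let ?C = "integral_closure (to_fract ` R) (fraction_field R)"
  obtain G where G: "G \<subseteq> ?C" "finite G" "?C = {\<Sum>g\<in>G. c g * g | c. c ` G \<subseteq> to_fract ` R}"
    using assms unfolding finite_integral_closure_def finitely_generated_module_def by blast
  have "G \<subseteq> localization R (R - {0})"
    using G(1) by (auto simp: integral_closure_def fraction_field_def)
  then obtain c where c: "c \<in> R - {0}" "\<And>g. g \<in> G \<Longrightarrow> to_fract c * g \<in> to_fract ` R"
    using S.common_denominator[OF G(2)] by blast
  have "to_fract c * y \<in> to_fract ` R" if "y \<in> fraction_field R" "integral_over (to_fract ` R) y" for y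
  proof -
    have "y \<in> ?C" using that by (simp add: integral_closure_def)
    then obtain d where d: "d ` G \<subseteq> to_fract ` R" "y = (\<Sum>g\<in>G. d g * g)" using G(3) by auto
    have "to_fract c * y = (\<Sum>g\<in>G. d g * (to_fract c * g))"
      by (simp add: d(2) sum_distrib_left algebra_simps)
    also have "\<dots> \<in> to_fract ` R"
      using d(1) by (intro I.sum_mem I.mult_mem c(2)) auto
    finally show ?thesis .
  qed
  with c(1) that show thesis by blast
qed

section \<open>The local integral degree at P compared with the one at the zero ideal\<close>

context
  fixes A B P :: "'a::idom set"
  assumes A: "type_subring A" and integral: "\<forall>b\<in>B. integral_over A b" and P: "P \<in> Spec A"
begin

interpretation type_subring A by (rule A)
interpretation K: multiplicative_subset A "A - {0}" by (rule multiplicative_subset_nonzero)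
interpretation L: multiplicative_subset A "A - P" by (rule multiplicative_subset_compl_prime[OF P])

lemma localization_subset_fraction_field:
  "localization C (A - P) \<subseteq> localization C (A - {0})"
  using L.zero_notin_S unfolding localization_def by blast

lemma local_integral_degree_zero_le: "local_integral_degree A B {0} \<le> local_integral_degree A B P"
  unfolding local_integral_degree_def integral_degree_def
proof (rule SUP_mono)
  fix x assume "x \<in> localization B (A - {0})"
  then obtain b s where x: "b \<in> B" "s \<in> A - {0}" "x = to_fract b / to_fract s"
    by (rule K.localizationE)
  interpret K': type_subring "localization A (A - {0})" by (rule K.type_subring_localization)
  \<comment> \<open>The fraction \<open>x\<close> need not lie in B_P, since \<open>s\<close> may
    belong to \<open>P\<close>. Its numerator does, and scaling by \<open>1 / s\<close> over the
    fraction field turns an equation of the numerator into one of \<open>x\<close> of the same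
    degree.\<close>
  have b: "to_fract b \<in> localization B (A - P)" using x(1) by (rule L.to_fract_mem_localization)
  define n where "n = elem_integral_degree (localization A (A - P)) (to_fract b)"
  have "monic_root (localization A (A - P)) (to_fract b) n"
    unfolding n_def using b L.integral_over_localization[OF integral]
    by (intro monic_root_elem_integral_degree L.type_subring_localization)
  then have "monic_root (localization A (A - {0})) (to_fract b) n"
    by (rule monic_root_mono[OF localization_subset_fraction_field])
  then have "monic_root (localization A (A - {0})) (to_fract 1 / to_fract s * to_fract b) n"
    using K.localizationI[OF one_mem x(2)] by (intro K'.monic_root_scale)
  then have "elem_integral_degree (localization A (A - {0})) x \<le> n"
    using x(3) by (intro elem_integral_degree_le K.type_subring_localization) simp
  then show "\<exists>y\<in>localization B (A - P). enat (elem_integral_degree (localization A (A - {0})) x)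
      \<le> enat (elem_integral_degree (localization A (A - P)) y)"
    using b unfolding n_def by auto
qed

text \<open>Since \<open>c\<close> is a unit in A_P, the conductor property makes A_P integrally
  closed. Each element of B_P can then be compared with itself, viewed over the fraction
  field.\<close>

lemma local_integral_degree_le_zero:
  assumes c: "c \<in> A - P"
    and conductor: "\<And>y. y \<in> fraction_field A \<Longrightarrow> integral_over (to_fract ` A) y \<Longrightarrow>
      to_fract c * y \<in> to_fract ` A"
  shows "local_integral_degree A B P \<le> local_integral_degree A B {0}"
proof -
  interpret K': type_subring "localization A (A - {0})" by (rule K.type_subring_localization)
  have inv: "inverse x \<in> localization A (A - {0})" if x: "x \<in> localization A (A - {0})" for x
  proof -
    obtain a s where as: "a \<in> A" "s \<in> A - {0}" "x = to_fract a / to_fract s"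
      using x by (rule K.localizationE)
    show ?thesis
    proof (cases "a = 0")
      \<comment> \<open>Here \<open>x = 0\<close>, and \<open>inverse 0 = 0\<close> by
        convention.\<close>
      case True
      then show ?thesis using as K'.zero_mem by simp
    next
      case False
      then have "to_fract s / to_fract a \<in> localization A (A - {0})"
        using as by (intro K.localizationI) auto
      then show ?thesis using as by simp
    qed
  qed
  \<comment> \<open>Some \<open>s\<close> outside \<open>P\<close> makes \<open>s * u\<close>
    integral over \<open>A\<close>; then \<open>c * s * u\<close> lies in \<open>A\<close>, and
    \<open>c * s\<close> is a denominator outside \<open>P\<close>.\<close>
  have normal: "u \<in> localization A (A - P)"
    if u: "u \<in> localization A (A - {0})" "integral_over (localization A (A - P)) u" for u
  proof -
    obtain s where s: "s \<in> A - P" "integral_over (to_fract ` A) (to_fract s * u)"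
      using L.clear_denominators[OF u(2)] by blast
    have "to_fract s * u \<in> fraction_field A"
      unfolding fraction_field_def using s(1) u(1)
      by (intro K'.mult_mem K.to_fract_mem_localization) auto
    then obtain a where a: "a \<in> A" "to_fract c * (to_fract s * u) = to_fract a"
      using conductor s(2) by blast
    then have "u = to_fract a / to_fract (c * s)"
      using L.to_fract_nonzero[OF c] L.to_fract_nonzero[OF s(1)] by (simp add: field_simps flip: a(2))
    then show ?thesis using L.localizationI[OF a(1) L.mult_mem_S[OF c s(1)]] by simp
  qed
  show ?thesis
    unfolding local_integral_degree_def integral_degree_def
  proof (rule SUP_mono)
    fix x assume x: "x \<in> localization B (A - P)"
    have "elem_integral_degree (localization A (A - P)) x
        \<le> elem_integral_degree (localization A (A - {0})) x"
      using L.integral_over_localization[OF integral x] normal inv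
      by (intro elem_integral_degree_le_fraction_field L.type_subring_localization
          K'.type_subring_axioms localization_subset_fraction_field)
    then show "\<exists>y\<in>localization B (A - {0}). enat (elem_integral_degree (localization A (A - P)) x)
        \<le> enat (elem_integral_degree (localization A (A - {0})) y)"
      using x localization_subset_fraction_field by auto
  qed
qed

end


section \<open>Primes of one-dimensional noetherian domains\<close>

text \<open>Noetherian induction. A maximal counterexample \<open>M\<close> is proper and not prime,
  so it contains some \<open>a \<otimes> b\<close> with neither factor in \<open>M\<close>. Every
  prime over \<open>M\<close> contains \<open>a\<close> or \<open>b\<close>, so finite families for
  the two ideals generated by \<open>M\<close> with \<open>a\<close> and by \<open>M\<close> with
  \<open>b\<close> combine to one for \<open>M\<close>.\<close>

lemma (in noetherian_ring) finite_primes_below_primes_over_ideal: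
  assumes "cring R" "ideal I R"
  shows "\<exists>F. finite F \<and> (\<forall>Q\<in>F. primeideal Q R \<and> I \<subseteq> Q) \<and>
    (\<forall>P. primeideal P R \<longrightarrow> I \<subseteq> P \<longrightarrow> (\<exists>Q\<in>F. Q \<subseteq> P))"
proof -
  define primes_cover where "primes_cover J F \<longleftrightarrow> finite F \<and> (\<forall>Q\<in>F. primeideal Q R \<and> J \<subseteq> Q) \<and>
    (\<forall>P. primeideal P R \<longrightarrow> J \<subseteq> P \<longrightarrow> (\<exists>Q\<in>F. Q \<subseteq> P))" for J F
  define bad where "bad = {J. ideal J R \<and> (\<forall>F. \<not> primes_cover J F)}"
  have "bad = {}"
  proof (rule ccontr)
    assume ne: "bad \<noteq> {}"
    have "\<exists>M\<in>bad. \<forall>J\<in>bad. M \<subseteq> J \<longrightarrow> J = M"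
    proof (rule subset_Zorn_nonempty[OF ne])
      fix C assume "C \<noteq> {}" and C: "subset.chain bad C"
      moreover have "subset.chain {J. ideal J R} C"
        using C unfolding subset.chain_def bad_def by blast
      \<comment> \<open>The ascending chain condition: a nonempty chain of ideals contains its
        union, which serves as the upper bound for Zorn's lemma.\<close>
      ultimately have "\<Union>C \<in> C" by (intro ideal_chain_is_trivial)
      then show "\<Union>C \<in> bad" using C unfolding subset.chain_def by blast
    qed
    then obtain M where "M \<in> bad" and max: "\<And>J. J \<in> bad \<Longrightarrow> M \<subseteq> J \<Longrightarrow> J = M" by blast
    then have M: "ideal M R" "\<And>F. \<not> primes_cover M F" by (auto simp: bad_def)
    interpret M: ideal M R by (rule M(1))
    have "\<not> primeideal M R" using M(2)[of "{M}"] by (auto simp: primes_cover_def)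
    \<comment> \<open>No prime contains the whole ring, so the empty family would cover it.\<close>
    moreover have "carrier R \<noteq> M"
    proof
      assume "carrier R = M"
      then have "\<not> M \<subseteq> P" if "primeideal P R" for P
        using primeideal.I_notcarr[OF that] ideal.Icarr[OF primeideal.axioms(1)[OF that]] by blast
      then show False using M(2)[of "{}"] by (auto simp: primes_cover_def)
    qed
    ultimately obtain a b where ab:
      "a \<in> carrier R" "b \<in> carrier R" "a \<otimes> b \<in> M" "a \<notin> M" "b \<notin> M"
      using primeidealI[OF M(1) assms(1)] by blast
    have larger: "M \<subseteq> Idl (insert x M)" "\<exists>F. primes_cover (Idl (insert x M)) F"
      if x: "x \<in> carrier R" "x \<notin> M" for x
    proof -
      have sub: "insert x M \<subseteq> Idl (insert x M)" using x M.a_subset by (intro genideal_self) auto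
      then show "M \<subseteq> Idl (insert x M)" by simp
      have "ideal (Idl (insert x M)) R" using x M.a_subset by (intro genideal_ideal) auto
      then show "\<exists>F. primes_cover (Idl (insert x M)) F"
        using max[of "Idl (insert x M)"] x sub unfolding bad_def by auto
    qed
    obtain F G where F: "primes_cover (Idl (insert a M)) F" and G: "primes_cover (Idl (insert b M)) G"
      using larger(2)[OF ab(1,4)] larger(2)[OF ab(2,5)] by blast
    have "\<exists>Q\<in>F \<union> G. Q \<subseteq> P" if P: "primeideal P R" "M \<subseteq> P" for P
    proof -
      have id: "ideal P R" by (rule primeideal.axioms(1)[OF P(1)])
      have "a \<in> P \<or> b \<in> P" using primeideal.I_prime[OF P(1) ab(1,2)] ab(3) P(2) by blast
      then show ?thesis
      proof
        assume "a \<in> P"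
        then have "Idl (insert a M) \<subseteq> P" using P(2) by (intro genideal_minimal[OF id]) simp
        then show ?thesis using F P(1) unfolding primes_cover_def by blast
      next
        assume "b \<in> P"
        then have "Idl (insert b M) \<subseteq> P" using P(2) by (intro genideal_minimal[OF id]) simp
        then show ?thesis using G P(1) unfolding primes_cover_def by blast
      qed
    qed
    moreover have "primeideal Q R \<and> M \<subseteq> Q" if "Q \<in> F \<union> G" for Q
    proof -
      have "primeideal Q R" "Idl (insert a M) \<subseteq> Q \<or> Idl (insert b M) \<subseteq> Q"
        using that F G unfolding primes_cover_def by auto
      then show ?thesis
        using subset_trans[OF larger(1)[OF ab(1,4)]] subset_trans[OF larger(1)[OF ab(2,5)]] by auto
    qed
    ultimately have "primes_cover M (F \<union> G)"
      using F G unfolding primes_cover_def by simp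
    with M(2) show False by simp
  qed
  then obtain F where "primes_cover I F" using assms(2) unfolding bad_def by blast
  then show ?thesis unfolding primes_cover_def by (rule exI)
qed

lemma Spec_subset: "P \<in> Spec A \<Longrightarrow> P \<subseteq> A"
  using ideal.Icarr[OF primeideal.axioms(1), of P "ring_on A"] by (auto simp: Spec_def)

text \<open>Otherwise \<open>{0}\<close>, \<open>Q\<close>, \<open>P\<close> would be a strict chain
  of primes of length 2.\<close>

lemma krull_dim_prime_maximal:
  assumes "krull_dim A = 1" "{0} \<in> Spec A" "P \<in> Spec A" "Q \<in> Spec A" "Q \<noteq> {0}" "Q \<subseteq> P"
  shows "Q = P"
proof (rule ccontr)
  assume "Q \<noteq> P"
  have "0 \<in> Q"
    using additive_subgroup.zero_closed[OF ideal.axioms(1)[OF primeideal.axioms(1)], of Q "ring_on A"] assms(4)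
    by (simp add: Spec_def ring_of_type_algebra_def)
  define C where "C = (\<lambda>i::nat. if i = 0 then {0} else if i = 1 then Q else P)"
  have "(\<forall>i\<le>2. C i \<in> Spec A) \<and> (\<forall>i<2. C i \<subset> C (Suc i))"
    using assms(2-6) \<open>0 \<in> Q\<close> \<open>Q \<noteq> P\<close> by (auto simp: C_def less_2_cases_iff)
  then have "enat 2 \<le> krull_dim A"
    unfolding krull_dim_def by (intro Sup_upper) blast
  then have "enat 2 \<le> enat 1" unfolding assms(1) one_enat_def .
  then show False by simp
qed

text \<open>Finitely many primes over the ideal generated by \<open>c\<close> lie below all others.
  Each of them contains \<open>c\<close>, so it is nonzero, and in dimension one it equals every
  prime above it.\<close>

lemma finite_primes_containing:
  assumes "noetherian_domain (ring_on A)" "krull_dim A = 1" "c \<in> A" "c \<noteq> 0"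
  shows "finite {P \<in> Spec A. c \<in> P}"
proof -
  interpret noetherian_domain "ring_on A" by fact
  have [simp]: "zero (ring_on A) = 0" by (simp add: ring_of_type_algebra_def)
  have zero: "{0} \<in> Spec A" using zeroprimeideal by (simp add: Spec_def)
  have id: "ideal (genideal (ring_on A) {c}) (ring_on A)" using assms(3) by (intro genideal_ideal) simp
  obtain F where F: "finite F" "\<And>Q. Q \<in> F \<Longrightarrow> Q \<in> Spec A \<and> genideal (ring_on A) {c} \<subseteq> Q"
    "\<And>P. P \<in> Spec A \<Longrightarrow> genideal (ring_on A) {c} \<subseteq> P \<Longrightarrow> \<exists>Q\<in>F. Q \<subseteq> P"
    using finite_primes_below_primes_over_ideal[OF is_cring id] unfolding Spec_def mem_Collect_eq
    by metis
  have "P \<in> F" if P: "P \<in> Spec A" "c \<in> P" for P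
  proof -
    have "genideal (ring_on A) {c} \<subseteq> P"
      using P by (intro genideal_minimal) (auto simp: Spec_def intro: primeideal.axioms(1))
    then obtain Q where Q: "Q \<in> F" "Q \<subseteq> P" using F(3) P(1) by blast
    have "c \<in> Q" using F(2)[OF Q(1)] genideal_self'[of c] assms(3) by auto
    then have "Q \<noteq> {0}" using assms(4) by auto
    then show ?thesis
      using krull_dim_prime_maximal[OF assms(2) zero P(1)] F(2) Q by blast
  qed
  then have "{P \<in> Spec A. c \<in> P} \<subseteq> F" by blast
  then show ?thesis using F(1) by (rule finite_subset)
qed

text \<open>A nonzero prime \<open>P\<close> is the only prime containing \<open>P\<close>, so its
  singleton is closed, and finite unions of closed sets are closed.\<close>

lemma closedin_zariski_finite:
  assumes "subring A ring_of_type_algebra" "{0} \<in> Spec A" "krull_dim A = 1"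
    "finite S" "S \<subseteq> Spec A - {{0}}"
  shows "closedin (zariski A) S"
proof -
  have "closedin (zariski A) {P}" if "P \<in> S" for P
  proof -
    have P: "P \<in> Spec A" "P \<noteq> {0}" using that assms(5) by auto
    have "{P} = zariski_closed_set A P"
      using P krull_dim_prime_maximal[OF assms(3,2) _ P] by (auto simp: zariski_closed_set_def)
    then show ?thesis unfolding closedin_zariski[OF assms(1)] using Spec_subset[OF P(1)] by blast
  qed
  then have "closedin (zariski A) (\<Union>P\<in>S. {P})" using assms(4) by (intro closedin_Union) auto
  then show ?thesis by simp
qed


section \<open>Semicontinuity\<close>

theorem theorem7p2:
  fixes A B :: "'a::idom set"
  assumes "integral_extension A B"
    and "noetherian_domain (ring_on A)"
    and "krull_dim A = 1"
    and "finite_integral_closure A"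
  shows "upper_semicontinuous_Spec A (local_integral_degree A B)"
proof -
  have A: "subring A ring_of_type_algebra" and integral: "\<forall>b\<in>B. integral_over A b"
    using assms(1) by (auto simp: integral_extension_def ring_extension_def)
  interpret type_subring A by (rule type_subring_of_subring[OF A])
  have "primeideal {\<zero>\<^bsub>ring_on A\<^esub>} (ring_on A)"
    using noetherian_domain.axioms(2)[OF assms(2)] by (rule domain.zeroprimeideal)
  then have zero: "{0} \<in> Spec A" by (simp add: Spec_def ring_of_type_algebra_def)
  obtain c where c: "c \<in> A" "c \<noteq> 0" "\<And>y. y \<in> fraction_field A \<Longrightarrow>
      integral_over (to_fract ` A) y \<Longrightarrow> to_fract c * y \<in> to_fract ` A"
    using conductor_nonzero[OF assms(4)] by blast
  have "closedin (zariski A) {P \<in> Spec A. enat n \<le> local_integral_degree A B P}" for n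
  proof (cases "enat n \<le> local_integral_degree A B {0}")
    case True
    \<comment> \<open>The bound at the zero ideal passes to every prime, and the empty set of
      equations cuts out the whole spectrum.\<close>
    then have "{P \<in> Spec A. enat n \<le> local_integral_degree A B P} = zariski_closed_set A {}"
      using local_integral_degree_zero_le[OF type_subring_axioms integral] order_trans
      by (auto simp: zariski_closed_set_def)
    then show ?thesis unfolding closedin_zariski[OF A] by blast
  next
    case False
    have "{P \<in> Spec A. enat n \<le> local_integral_degree A B P} \<subseteq> {P \<in> Spec A. c \<in> P}"
    proof clarify
      fix P assume P: "P \<in> Spec A" "enat n \<le> local_integral_degree A B P"
      show "c \<in> P"
      proof (rule ccontr)
        assume "c \<notin> P"
        then have "local_integral_degree A B P \<le> local_integral_degree A B {0}"
          using local_integral_degree_le_zero[OF type_subring_axioms integral P(1) _ c(3)] c(1) by blast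
        with P(2) False show False by (auto dest: order_trans)
      qed
    qed
    \<comment> \<open>The zero ideal is not in this finite set because \<open>c \<noteq> 0\<close>,
      so the set consists of closed points.\<close>
    then show ?thesis
      using finite_subset[OF _ finite_primes_containing[OF assms(2,3) c(1,2)]] c(2)
      by (intro closedin_zariski_finite[OF A zero assms(3)]) auto
  qed
  then show ?thesis by (simp add: upper_semicontinuous_Spec_def)
qed

end
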